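(* Let $\Delta\ge 6$ and let $n=k\Delta+1+j$, where $k\geq\Delta-1$ and $2\leq j\leq\Delta-2$ are integers. Then the family $\mathcal{T}'''_{n,\Delta}$ is not empty and all trees in $\mathcal{T}'''_{n,\Delta}$ have the same value of $\sigma$-irregularity.
   Context: For a graph $G$, $\sigma(G)=\sum_{uv\in E(G)}(d(u)-d(v))^2$, where $d(u)$ is the degree of $u$. For a tree $T$, $m_{ij}=m_{ji}$ is the number of edges whose end-vertices have degrees $i$ and $j$. An internal leaf of a tree is a vertex of degree at least $2$ having precisely one neighbor of degree greater than $1$. A medium vertex is a vertex whose degree lies in $\{3,\ldots,\Delta-1\}$. The family $\mathcal{T}'''_{n,\Delta}$ consists of all trees $T$ on $n=k\Delta+1+j$ vertices with maximum degree $\Delta$ such that: (1) all internal leaves of $T$ have degree $\Delta$; (2) all vertices of $T$ have degree in $\{1,2,\Delta\}$, except precisely one medium vertex $w$, which has degree $j+1$; (3) $m_{22}=0$; (4) $w$ has precisely $j$ neighbors of degree $2$ and one neighbor of degree $\Delta$; (5) $m_{\Delta\Delta}=0$. *)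

theory Defs
  imports Main
begin

record 'a sgraph =
  verts :: "'a set"
  edges :: "'a set set"

definition simple_graph :: "'a sgraph \<Rightarrow> bool" where
  "simple_graph G \<longleftrightarrow> finite (verts G) \<and>
     (\<forall>e\<in>edges G. \<exists>u\<in>verts G. \<exists>v\<in>verts G. u \<noteq> v \<and> e = {u, v})"

definition nbrs :: "'a sgraph \<Rightarrow> 'a \<Rightarrow> 'a set" where
  "nbrs G v = {u \<in> verts G. {u, v} \<in> edges G}"

definition deg :: "'a sgraph \<Rightarrow> 'a \<Rightarrow> nat" where
  "deg G v = card (nbrs G v)"

definition max_deg :: "'a sgraph \<Rightarrow> nat" where
  "max_deg G = Max (deg G ` verts G)"

definition walk :: "'a sgraph \<Rightarrow> 'a list \<Rightarrow> bool" where
  "walk G xs \<longleftrightarrow> xs \<noteq> [] \<and> set xs \<subseteq> verts G \<and> successively (\<lambda>u v. {u, v} \<in> edges G) xs"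

definition connected_graph :: "'a sgraph \<Rightarrow> bool" where
  "connected_graph G \<longleftrightarrow> verts G \<noteq> {} \<and>
     (\<forall>u\<in>verts G. \<forall>v\<in>verts G. \<exists>xs. walk G xs \<and> hd xs = u \<and> last xs = v)"

text \<open>A cycle is listed without repeating its first vertex at the end.\<close>
definition is_cycle :: "'a sgraph \<Rightarrow> 'a list \<Rightarrow> bool" where
  "is_cycle G xs \<longleftrightarrow> walk G xs \<and> distinct xs \<and> length xs \<ge> 3 \<and> {last xs, hd xs} \<in> edges G"

definition is_tree :: "'a sgraph \<Rightarrow> bool" where
  "is_tree G \<longleftrightarrow> simple_graph G \<and> connected_graph G \<and> (\<nexists>xs. is_cycle G xs)"

text \<open>The summand of an edge is symmetric in its end-vertices, so the description below is unique;
  the lemma after it confirms this.\<close>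
definition edge_imbalance :: "'a sgraph \<Rightarrow> 'a set \<Rightarrow> int" where
  "edge_imbalance G e = (THE x. \<exists>u v. e = {u, v} \<and> x = (int (deg G u) - int (deg G v))\<^sup>2)"

lemma edge_imbalance_pair:
  "edge_imbalance G {u, v} = (int (deg G u) - int (deg G v))\<^sup>2"
  unfolding edge_imbalance_def
  by (rule the_equality) (auto simp: doubleton_eq_iff power2_commute)

definition sigma_irr :: "'a sgraph \<Rightarrow> int" where
  "sigma_irr G = (\<Sum>e\<in>edges G. edge_imbalance G e)"

definition m_edges :: "'a sgraph \<Rightarrow> nat \<Rightarrow> nat \<Rightarrow> nat" where
  "m_edges G i j = card {e \<in> edges G. \<exists>u v. e = {u, v} \<and> deg G u = i \<and> deg G v = j}"

definition internal_leaf :: "'a sgraph \<Rightarrow> 'a \<Rightarrow> bool" where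
  "internal_leaf G v \<longleftrightarrow> v \<in> verts G \<and> deg G v \<ge> 2 \<and> card {u \<in> nbrs G v. deg G u > 1} = 1"

definition medium_vertex :: "'a sgraph \<Rightarrow> 'a \<Rightarrow> bool" where
  "medium_vertex G v \<longleftrightarrow> v \<in> verts G \<and> deg G v \<in> {3..max_deg G - 1}"

text \<open>The numbers \<open>k\<close> and \<open>j\<close> are determined by \<open>n\<close> and \<open>\<Delta>\<close>, because \<open>2 \<le> j \<le> \<Delta> - 2\<close>.\<close>
definition T_family :: "nat \<Rightarrow> nat \<Rightarrow> 'a sgraph set" where
  "T_family n \<Delta> = {T. is_tree T \<and> card (verts T) = n \<and> max_deg T = \<Delta> \<and>
     (\<exists>k j. n = k * \<Delta> + 1 + j \<and> 2 \<le> j \<and> j \<le> \<Delta> - 2 \<and>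
       (\<forall>v. internal_leaf T v \<longrightarrow> deg T v = \<Delta>) \<and>
       (\<exists>w. medium_vertex T w \<and> deg T w = j + 1 \<and>
          (\<forall>v\<in>verts T - {w}. deg T v \<in> {1, 2, \<Delta>}) \<and>
          card {u \<in> nbrs T w. deg T u = 2} = j \<and>
          card {u \<in> nbrs T w. deg T u = \<Delta>} = 1) \<and>
       m_edges T 2 2 = 0 \<and>
       m_edges T \<Delta> \<Delta> = 0)}"

end

theory Submission
  imports Defs "HOL-Library.Nat_Bijection"
begin

text \<open>
  Let \<open>A\<close> be the set of vertices of degree 1 or 2. The conditions make \<open>A\<close> independent: a neighbour of
  a leaf has degree \<open>\<Delta>\<close>, and a neighbour of a vertex of degree 2 has degree \<open>\<Delta>\<close> or is \<open>w\<close>.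
  Every edge except the one joining \<open>w\<close> to a vertex of degree \<open>\<Delta>\<close> therefore has exactly one end
  in \<open>A\<close>, so \<open>\<sigma>\<close> depends only on \<open>n\<^sub>1\<close>, \<open>n\<^sub>2\<close>, \<open>\<Delta>\<close> and \<open>j\<close>, and the number of edges is
  \<open>n - 1 = 1 + n\<^sub>1 + 2 n\<^sub>2\<close>. The vertices of degree \<open>\<Delta>\<close> are also independent and meet
  all edges but the \<open>j\<close> ones joining \<open>w\<close> to vertices of degree 2, so
  \<open>\<Delta> n\<^sub>\<Delta> = n - 1 - j = k \<Delta>\<close>. Together with \<open>n = 1 + n\<^sub>1 + n\<^sub>2 + n\<^sub>\<Delta>\<close> this determines
  \<open>n\<^sub>1 = n - 2 k\<close> and \<open>n\<^sub>2 = k - 1\<close>.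
\<close>

section \<open>Trees have one edge fewer than vertices\<close>

lemma simple_graph_edgeD:
  assumes "simple_graph G" "{u, v} \<in> edges G"
  shows "u \<in> verts G" "v \<in> verts G" "u \<noteq> v"
  using assms unfolding simple_graph_def by (fastforce simp: doubleton_eq_iff)+

lemma simple_graph_edgeE:
  assumes "simple_graph G" "e \<in> edges G"
  obtains u v where "e = {u, v}" "u \<in> verts G" "v \<in> verts G" "u \<noteq> v"
  using assms unfolding simple_graph_def by blast

lemma finite_edges:
  assumes "simple_graph G"
  shows "finite (edges G)"
proof (rule finite_subset)
  show "edges G \<subseteq> Pow (verts G)"
    using assms unfolding simple_graph_def by auto
  show "finite (Pow (verts G))"
    using assms unfolding simple_graph_def by simp
qed

lemma finite_nbrs: "simple_graph G \<Longrightarrow> finite (nbrs G v)"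
  unfolding simple_graph_def nbrs_def by simp

lemma nbrs_iff: "simple_graph G \<Longrightarrow> u \<in> nbrs G v \<longleftrightarrow> {u, v} \<in> edges G"
  unfolding nbrs_def using simple_graph_edgeD(1) by fastforce

lemma nbrs_commute: "simple_graph G \<Longrightarrow> u \<in> nbrs G v \<longleftrightarrow> v \<in> nbrs G u"
  by (simp add: nbrs_iff insert_commute)

lemma walk_Cons:
  "walk G (x # xs) \<longleftrightarrow> x \<in> verts G \<and> (xs = [] \<or> walk G xs \<and> {x, hd xs} \<in> edges G)"
  unfolding walk_def by (cases xs) auto

lemma walk_crossing:
  assumes "walk G xs" "hd xs \<in> S" "last xs \<notin> S"
  obtains a b where "{a, b} \<in> edges G" "a \<in> S" "b \<in> verts G - S"
  using assms
proof (induction xs arbitrary: thesis)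
  case Nil
  then show ?case by (simp add: walk_def)
next
  case (Cons x xs)
  then have "xs \<noteq> []" by auto
  with Cons.prems have *: "walk G xs" "{x, hd xs} \<in> edges G" by (auto simp: walk_Cons)
  show ?case
  proof (cases "hd xs \<in> S")
    case True
    with Cons.IH * Cons.prems \<open>xs \<noteq> []\<close> show ?thesis by auto
  next
    case False
    moreover have "hd xs \<in> verts G" using * by (auto simp: walk_def)
    ultimately show ?thesis using Cons.prems * by auto
  qed
qed

lemma connected_crossing:
  assumes "connected_graph G" "u \<in> verts G" "u \<in> S" "v \<in> verts G" "v \<notin> S"
  obtains a b where "{a, b} \<in> edges G" "a \<in> S" "b \<in> verts G - S"
  using assms walk_crossing unfolding connected_graph_def by metis

text \<open>Grow a vertex set from one vertex: by connectedness an edge leaves any proper nonempty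
  part, and adding its outer end adds a new spanned edge.\<close>

lemma connected_card_le:
  assumes G: "simple_graph G" "connected_graph G"
  shows "card (verts G) \<le> card (edges G) + 1"
proof -
  have fin: "finite (verts G)" using G by (simp add: simple_graph_def)
  have grow: "\<exists>S\<subseteq>verts G. card S = Suc m \<and> m \<le> card {e \<in> edges G. e \<subseteq> S}"
    if "Suc m \<le> card (verts G)" for m
    using that
  proof (induction m)
    case 0
    obtain v where "v \<in> verts G" using G by (auto simp: connected_graph_def)
    then show ?case by (intro exI[of _ "{v}"]) auto
  next
    case (Suc m)
    then obtain S where S: "S \<subseteq> verts G" "card S = Suc m" "m \<le> card {e \<in> edges G. e \<subseteq> S}"
      by auto
    have "S \<noteq> {}" "S \<noteq> verts G" using S Suc.prems by auto
    then obtain u v where "u \<in> S" "v \<in> verts G - S" using S by blast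
    then obtain a b where ab: "{a, b} \<in> edges G" "a \<in> S" "b \<in> verts G - S"
      using connected_crossing[OF G(2), of u S v] S by blast
    let ?E = "{e \<in> edges G. e \<subseteq> S}"
    have "insert {a, b} ?E \<subseteq> {e \<in> edges G. e \<subseteq> insert b S}" using ab by auto
    moreover have "finite {e \<in> edges G. e \<subseteq> insert b S}" using finite_edges[OF G(1)] by simp
    ultimately have "card (insert {a, b} ?E) \<le> card {e \<in> edges G. e \<subseteq> insert b S}"
      by (rule card_mono[rotated])
    moreover have "card (insert {a, b} ?E) = Suc (card ?E)"
      using ab finite_edges[OF G(1)] by simp
    moreover have "card (insert b S) = Suc (card S)"
      using ab S(1) fin finite_subset by fastforce
    ultimately show ?case using S ab by (intro exI[of _ "insert b S"]) auto
  qed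
  have "card (verts G) \<noteq> 0" using fin G(2) by (simp add: connected_graph_def)
  then obtain m where m: "card (verts G) = Suc m" by (cases "card (verts G)") auto
  then obtain S where "m \<le> card {e \<in> edges G. e \<subseteq> S}" using grow[of m] by auto
  also have "\<dots> \<le> card (edges G)" by (rule card_mono) (auto simp: finite_edges[OF G(1)])
  finally show ?thesis using m by simp
qed

text \<open>Otherwise take a longest path. Its first vertex has a neighbour besides the second
  vertex; by maximality that neighbour lies on the path and closes a cycle.\<close>

lemma acyclic_obtains_low_degree:
  assumes G: "simple_graph G" "verts G \<noteq> {}" "\<nexists>xs. is_cycle G xs"
  obtains v where "v \<in> verts G" "deg G v \<le> 1"
proof (rule ccontr)
  assume "\<not> thesis"
  with that have deg2: "\<And>v. v \<in> verts G \<Longrightarrow> deg G v \<ge> 2" by force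
  let ?P = "\<lambda>xs. walk G xs \<and> distinct xs"
  have fin: "finite (verts G)" using G by (simp add: simple_graph_def)
  obtain r where "r \<in> verts G" using G by auto
  then have "?P [r]" by (simp add: walk_def)
  moreover have "\<forall>xs. ?P xs \<longrightarrow> length xs < Suc (card (verts G))"
    using fin by (auto simp: walk_def less_Suc_eq_le simp flip: distinct_card intro: card_mono)
  ultimately obtain xs where xs: "?P xs" and max: "\<And>ys. ?P ys \<Longrightarrow> length ys \<le> length xs"
    using ex_has_greatest_nat[of ?P "[r]" length] by blast
  obtain v ys where vys: "xs = v # ys" using xs by (cases xs) (auto simp: walk_def)
  have v: "v \<in> verts G" using xs vys by (simp add: walk_def)
  have longer: False if "u \<in> nbrs G v" "u \<notin> set xs" for u
  proof -
    have "?P (u # xs)" using that xs vys by (auto simp: walk_Cons nbrs_def)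
    then show False using max by fastforce
  qed
  \<comment> \<open>For empty \<open>ys\<close> the value \<open>hd ys\<close> is unspecified, but
    \<open>{hd ys}\<close> still has only one element, so the cardinality argument stands.\<close>
  have "\<not> nbrs G v \<subseteq> {hd ys}"
    using deg2[OF v] card_mono[of "{hd ys}" "nbrs G v"] by (auto simp: deg_def)
  then obtain u where u: "u \<in> nbrs G v" "u \<noteq> hd ys" by blast
  then have edge: "{u, v} \<in> edges G" by (simp add: nbrs_def)
  then have "u \<noteq> v" using simple_graph_edgeD[OF G(1)] by blast
  moreover have "u \<in> set xs" using longer u by blast
  ultimately have "u \<in> set ys" using vys by simp
  with u(2) obtain y as bs where ys: "ys = (y # as) @ u # bs"
    by (cases ys) (auto dest: split_list)
  have "successively (\<lambda>u v. {u, v} \<in> edges G) ((v # y # as @ [u]) @ bs)"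
    using xs vys ys by (simp add: walk_def)
  then have "successively (\<lambda>u v. {u, v} \<in> edges G) (v # y # as @ [u])"
    unfolding successively_append_iff by blast
  then have "is_cycle G (v # y # as @ [u])"
    using xs vys ys edge unfolding is_cycle_def walk_def by auto
  with G(3) show False by blast
qed

text \<open>Deleting a vertex of degree at most 1 loses at most one edge and creates no cycle. The
  induction hypothesis asks for a nonempty vertex set, so a single vertex is treated apart.\<close>

lemma acyclic_card_ge:
  assumes "simple_graph G" "verts G \<noteq> {}" "\<nexists>xs. is_cycle G xs"
  shows "card (edges G) + 1 \<le> card (verts G)"
  using assms
proof (induction "card (verts G)" arbitrary: G rule: less_induct)
  case less
  have fin: "finite (verts G)" using less by (simp add: simple_graph_def)
  obtain v where v: "v \<in> verts G" "deg G v \<le> 1"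
    using acyclic_obtains_low_degree less.prems by blast
  define H where "H = \<lparr>verts = verts G - {v}, edges = {e \<in> edges G. v \<notin> e}\<rparr>"
  have "edges G \<subseteq> edges H \<union> (\<lambda>u. {u, v}) ` nbrs G v"
    using less.prems(1) unfolding simple_graph_def H_def nbrs_def
    by (fastforce simp: insert_commute)
  then have "card (edges G) \<le> card (edges H \<union> (\<lambda>u. {u, v}) ` nbrs G v)"
    using less.prems(1) by (intro card_mono) (auto simp: H_def finite_edges finite_nbrs)
  also have "\<dots> \<le> card (edges H) + card ((\<lambda>u. {u, v}) ` nbrs G v)" by (rule card_Un_le)
  also have "card ((\<lambda>u. {u, v}) ` nbrs G v) \<le> 1"
    using card_image_le[OF finite_nbrs[OF less.prems(1)], of "\<lambda>u. {u, v}" v] v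
    by (simp add: deg_def)
  finally have *: "card (edges G) \<le> card (edges H) + 1" by simp
  show ?case
  proof (cases "verts H = {}")
    case True
    then have "verts G = {v}" using v by (auto simp: H_def)
    then have "edges G = {}" using less.prems(1) by (auto simp: simple_graph_def)
    then show ?thesis using \<open>verts G = {v}\<close> by simp
  next
    case False
    have "simple_graph H" using less.prems(1) unfolding simple_graph_def H_def by fastforce
    moreover have "is_cycle G xs" if "is_cycle H xs" for xs
      using that unfolding is_cycle_def walk_def H_def
      by (auto elim: successively_mono)
    moreover have card: "card (verts H) = card (verts G) - 1" using v by (simp add: H_def)
    moreover have "card (verts G) > 0" using v fin by (auto simp: card_gt_0_iff)
    ultimately have "card (edges H) + 1 \<le> card (verts H)"
      using less.hyps[of H] less.prems False by auto
    then show ?thesis using * card by simp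
  qed
qed

lemma tree_card_verts: "is_tree G \<Longrightarrow> card (verts G) = card (edges G) + 1"
  using connected_card_le acyclic_card_ge unfolding is_tree_def connected_graph_def
  by (metis le_antisym)

section \<open>The irregularity of a member of the family\<close>

text \<open>Independence gives each edge meeting \<open>A\<close> exactly one end in
  \<open>A\<close>, so such edges correspond to pairs of a vertex of \<open>A\<close> and a
  neighbour. With \<open>f\<close> constantly 1 this counts edges.\<close>

lemma sum_edges_meeting_independent:
  assumes G: "simple_graph G"
    and A: "A \<subseteq> verts G" "\<And>u v. u \<in> A \<Longrightarrow> v \<in> A \<Longrightarrow> {u, v} \<notin> edges G"
  shows "(\<Sum>e\<in>{e \<in> edges G. e \<inter> A \<noteq> {}}. f e) = (\<Sum>v\<in>A. \<Sum>u\<in>nbrs G v. f {u, v})"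
proof -
  have "finite A" using A G finite_subset by (auto simp: simple_graph_def)
  have "(\<Sum>v\<in>A. \<Sum>u\<in>nbrs G v. f {u, v}) = (\<Sum>(v, u)\<in>Sigma A (nbrs G). f {u, v})"
    using \<open>finite A\<close> finite_nbrs[OF G] by (simp add: sum.Sigma)
  also have "\<dots> = (\<Sum>e\<in>{e \<in> edges G. e \<inter> A \<noteq> {}}. f e)"
  proof -
    have "bij_betw (\<lambda>(v, u). {u, v}) (Sigma A (nbrs G)) {e \<in> edges G. e \<inter> A \<noteq> {}}"
      unfolding bij_betw_def
    proof
      show "inj_on (\<lambda>(v, u). {u, v}) (Sigma A (nbrs G))"
        using A(2) by (auto simp: inj_on_def nbrs_iff[OF G] doubleton_eq_iff)
      show "(\<lambda>(v, u). {u, v}) ` Sigma A (nbrs G) = {e \<in> edges G. e \<inter> A \<noteq> {}}"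
      proof
        show "{e \<in> edges G. e \<inter> A \<noteq> {}} \<subseteq> (\<lambda>(v, u). {u, v}) ` Sigma A (nbrs G)"
        proof
          fix e assume e: "e \<in> {e \<in> edges G. e \<inter> A \<noteq> {}}"
          then obtain a b where "e = {a, b}" using simple_graph_edgeE[OF G] by blast
          with e obtain u v where "e = {u, v}" "v \<in> A" by auto
          then show "e \<in> (\<lambda>(v, u). {u, v}) ` Sigma A (nbrs G)"
            using e by (auto simp: nbrs_iff[OF G] intro!: image_eqI[of _ _ "(v, u)"])
        qed
      qed (auto simp: nbrs_iff[OF G])
    qed
    from sum.reindex_bij_betw[OF this, of f] show ?thesis by (simp add: case_prod_beta')
  qed
  finally show ?thesis ..
qed

text \<open>An edge leaves the closed neighbourhood of \<open>u\<close>. Its inner end is a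
  neighbour of \<open>u\<close> that is adjacent both to \<open>u\<close> and to a vertex
  outside.\<close>

lemma not_all_nbrs_leaves:
  assumes G: "simple_graph G" "connected_graph G"
    and u: "u \<in> verts G" and w: "w \<in> verts G" "w \<notin> insert u (nbrs G u)"
  obtains v where "v \<in> nbrs G u" "deg G v > 1"
proof -
  obtain a b where ab: "{a, b} \<in> edges G" "a \<in> insert u (nbrs G u)" "b \<notin> insert u (nbrs G u)"
    using connected_crossing[OF G(2) u _ w] by blast
  have "a \<noteq> u" using ab G(1) by (auto simp: nbrs_iff insert_commute)
  then have a: "a \<in> nbrs G u" using ab by simp
  have "{u, b} \<subseteq> nbrs G a" using a ab(1) G(1) by (auto simp: nbrs_iff insert_commute)
  then have "card {u, b} \<le> deg G a" unfolding deg_def by (intro card_mono finite_nbrs G)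
  moreover have "card {u, b} = 2" using ab by auto
  ultimately show ?thesis using a that by auto
qed

lemma m_edges_eq_0_iff:
  assumes "simple_graph G"
  shows "m_edges G i j = 0 \<longleftrightarrow> (\<forall>u v. {u, v} \<in> edges G \<longrightarrow> \<not> (deg G u = i \<and> deg G v = j))"
  using finite_edges[OF assms] unfolding m_edges_def by (auto simp: card_eq_0_iff)

text \<open>The summands come from the edge between \<open>w\<close> and its neighbour of degree
  \<Delta>, the \<open>n - 2 * k\<close> leaves, the \<open>k - 1\<close> vertices of degree 2 as if
  both neighbours had degree \<Delta>, and a correction for the \<open>j\<close> of them adjacent to
  \<open>w\<close>.\<close>

lemma T_family_sigma_irr:
  assumes T: "T \<in> T_family n \<Delta>"
    and n: "n = k * \<Delta> + 1 + j" "2 \<le> j" "j \<le> \<Delta> - 2"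
  shows "sigma_irr T = (int \<Delta> - int j - 1)\<^sup>2 + (int n - 2 * int k) * (int \<Delta> - 1)\<^sup>2
    + 2 * (int k - 1) * (int \<Delta> - 2)\<^sup>2 + int j * ((int j - 1)\<^sup>2 - (int \<Delta> - 2)\<^sup>2)"
proof -
  obtain k' j' w where kj': "n = k' * \<Delta> + 1 + j'" "2 \<le> j'" "j' \<le> \<Delta> - 2"
    and tree: "is_tree T" and card_n: "card (verts T) = n"
    and il: "\<And>v. internal_leaf T v \<Longrightarrow> deg T v = \<Delta>"
    and w: "w \<in> verts T" and dw': "deg T w = j' + 1"
    and others: "\<And>v. v \<in> verts T \<Longrightarrow> v \<noteq> w \<Longrightarrow> deg T v \<in> {1, 2, \<Delta>}"
    and w2': "card {u \<in> nbrs T w. deg T u = 2} = j'"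
    and w\<Delta>: "card {u \<in> nbrs T w. deg T u = \<Delta>} = 1"
    and m: "m_edges T 2 2 = 0" "m_edges T \<Delta> \<Delta> = 0"
    using T unfolding T_family_def medium_vertex_def by fastforce
  \<comment> \<open>Membership supplies its own parameters; \<open>j'\<close> equals
    \<open>j\<close> because both are the residue of \<open>n - 1\<close> modulo \<Delta>.\<close>
  have "j = (n - 1) mod \<Delta>" using n by simp
  moreover have "j' = (n - 1) mod \<Delta>" using kj' by simp
  ultimately have "j' = j" by simp
  note dw = dw'[unfolded this] and w2 = w2'[unfolded this]
  have G: "simple_graph T" and con: "connected_graph T" using tree by (auto simp: is_tree_def)
  note nb = nbrs_iff[OF G] and E = simple_graph_edgeD[OF G]
  have fin: "finite (verts T)" using G by (simp add: simple_graph_def)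
  have no22: "\<not> (deg T u = 2 \<and> deg T v = 2)" and no\<Delta>\<Delta>: "\<not> (deg T u = \<Delta> \<and> deg T v = \<Delta>)"
    if "{u, v} \<in> edges T" for u v
    using m that unfolding m_edges_eq_0_iff[OF G] by blast+
  have \<Delta>4: "\<Delta> \<ge> 4" using n by simp

  \<comment> \<open>The \<open>j\<close> neighbours of degree 2 and the one of degree \<Delta>
    already exhaust the \<open>j + 1\<close> neighbours of \<open>w\<close>.\<close>
  have nbrs_w: "deg T u \<in> {2, \<Delta>}" if "u \<in> nbrs T w" for u
  proof -
    let ?A = "{u \<in> nbrs T w. deg T u = 2}" and ?B = "{u \<in> nbrs T w. deg T u = \<Delta>}"
    have "card (?A \<union> ?B) = card ?A + card ?B"
      using finite_nbrs[OF G] \<Delta>4 by (intro card_Un_disjoint) auto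
    then have "card (nbrs T w) \<le> card (?A \<union> ?B)" using w2 w\<Delta> dw by (simp add: deg_def)
    then have "?A \<union> ?B = nbrs T w" by (intro card_seteq finite_nbrs G) auto
    then show ?thesis using that by auto
  qed
  have big_nbr: "\<exists>v\<in>nbrs T u. deg T v > 1" if "u \<in> verts T" "deg T u \<le> 2" for u
  proof (cases "w \<in> nbrs T u")
    case True
    then show ?thesis using dw n by (intro bexI[of _ w]) auto
  next
    case False
    moreover have "w \<noteq> u" using that dw n by auto
    ultimately show ?thesis using not_all_nbrs_leaves[OF G con that(1) w] by (metis insertE)
  qed
  \<comment> \<open>With a leaf as one neighbour, a vertex of degree 2 would have exactly one
    neighbour of degree above 1, hence be an internal leaf of degree other than \<Delta>.\<close>
  have nbrs2_big: "deg T v > 1" if "u \<in> verts T" "deg T u = 2" "v \<in> nbrs T u" for u v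
  proof (rule ccontr)
    assume v: "\<not> deg T v > 1"
    from that have "\<exists>x\<in>nbrs T u. deg T x > 1" by (intro big_nbr) auto
    then obtain x where x: "x \<in> nbrs T u" "deg T x > 1" by blast
    have "v \<noteq> x" using x v by auto
    then have "nbrs T u = {v, x}"
      using x v that by (intro card_seteq[symmetric] finite_nbrs G) (auto simp: deg_def)
    then have "{y \<in> nbrs T u. deg T y > 1} = {x}" using x v by auto
    then have "internal_leaf T u" using that by (simp add: internal_leaf_def)
    then show False using il that \<Delta>4 by fastforce
  qed
  have nbrs2: "v = w \<or> v \<noteq> w \<and> deg T v = \<Delta>" if "{u, v} \<in> edges T" "deg T u = 2" for u v
    using nbrs2_big[of u v] others[of v] no22[of u v] that E[of u v]
    by (auto simp: nb insert_commute)
  have nbrs1: "deg T v = \<Delta>" if "{u, v} \<in> edges T" "deg T u = 1" for u v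
  proof -
    have v: "v \<in> nbrs T u" "u \<in> nbrs T v" "u \<in> verts T" "v \<in> verts T"
      using that E[of u v] by (auto simp: nb insert_commute)
    then have "v \<noteq> w" using nbrs_w[of u] that \<Delta>4 by auto
    moreover have "deg T v \<noteq> 2" using nbrs2_big[of v u] v that by auto
    moreover have "\<exists>x\<in>nbrs T u. deg T x > 1" using v that by (intro big_nbr) auto
    then have "deg T v \<noteq> 1"
      using that v by (auto simp: deg_def card_1_singleton_iff)
    ultimately show ?thesis using others[OF v(4)] by auto
  qed

  let ?V1 = "{v \<in> verts T. deg T v = 1}" and ?V2 = "{v \<in> verts T. deg T v = 2}"
  let ?VD = "{v \<in> verts T. deg T v = \<Delta>}"
  obtain c where c: "{u \<in> nbrs T w. deg T u = \<Delta>} = {c}" using w\<Delta> card_1_singletonE by blast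
  then have c': "c \<in> nbrs T w" "deg T c = \<Delta>" by blast+
  then have cw: "{c, w} \<in> edges T" by (simp add: nb)
  have dwne: "deg T w \<noteq> 1" "deg T w \<noteq> 2" "deg T w \<noteq> \<Delta>" using dw n by auto
  \<comment> \<open>Outside \<open>?V1\<close> and \<open>?V2\<close> only \<open>w\<close> and the
    pairwise nonadjacent vertices of degree \<Delta> remain, so the edge must join \<open>w\<close>
    to \<open>c\<close>.\<close>
  have wc: "{c, w} = {u, v}" if "{u, v} \<in> edges T" "{u, v} \<inter> (?V1 \<union> ?V2) = {}" for u v
  proof -
    have *: "u = w \<or> deg T u = \<Delta>" "v = w \<or> deg T v = \<Delta>" "u \<noteq> v"
      using others[of u] others[of v] that E[of u v] by auto
    show ?thesis
    proof (cases "u = w")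
      case True
      then have "v \<in> {u \<in> nbrs T w. deg T u = \<Delta>}" using * that by (auto simp: nb insert_commute)
      then show ?thesis using c True by auto
    next
      case False
      then have "v = w" using * no\<Delta>\<Delta>[OF that(1)] by auto
      then have "u \<in> {u \<in> nbrs T w. deg T u = \<Delta>}" using * that by (auto simp: nb)
      then show ?thesis using c \<open>v = w\<close> by auto
    qed
  qed
  have E_split: "edges T = insert {c, w} {e \<in> edges T. e \<inter> (?V1 \<union> ?V2) \<noteq> {}}" (is "_ = insert _ ?E")
  proof -
    have "e = {c, w}" if e: "e \<in> edges T" "e \<inter> (?V1 \<union> ?V2) = {}" for e
    proof -
      obtain u v where "e = {u, v}" using simple_graph_edgeE[OF G e(1)] by blast
      then show ?thesis using wc[of u v] e by simp
    qed
    then show ?thesis using cw by blast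
  qed
  have cw_notin: "{c, w} \<notin> ?E" using c' dwne \<Delta>4 by auto
  have indep: "{u, v} \<notin> edges T" if "u \<in> ?V1 \<union> ?V2" "v \<in> ?V1 \<union> ?V2" for u v
    using that nbrs1[of u v] nbrs2[of u v] dwne \<Delta>4 by auto
  \<comment> \<open>Kept general in \<open>f\<close>: the constant 1 counts the edges,
    \<open>edge_imbalance\<close> gives the irregularity.\<close>
  have sum_edges: "(\<Sum>e\<in>edges T. f e) = f {c, w} + (\<Sum>v\<in>?V1. \<Sum>u\<in>nbrs T v. f {u, v})
      + (\<Sum>v\<in>?V2. \<Sum>u\<in>nbrs T v. f {u, v})" for f :: "_ \<Rightarrow> int"
  proof -
    have "(\<Sum>e\<in>edges T. f e) = f {c, w} + (\<Sum>e\<in>?E. f e)"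
      using cw_notin finite_edges[OF G] by (subst E_split, subst sum.insert) auto
    also have "(\<Sum>e\<in>?E. f e) = (\<Sum>v\<in>?V1 \<union> ?V2. \<Sum>u\<in>nbrs T v. f {u, v})"
      by (rule sum_edges_meeting_independent[OF G _ indep]) auto
    also have "\<dots> = (\<Sum>v\<in>?V1. \<Sum>u\<in>nbrs T v. f {u, v}) + (\<Sum>v\<in>?V2. \<Sum>u\<in>nbrs T v. f {u, v})"
      using fin by (intro sum.union_disjoint) auto
    finally show ?thesis by simp
  qed

  have card_E: "n = card (edges T) + 1" using tree_card_verts[OF tree] card_n by simp
  have "int (card (edges T)) = 1 + int (card ?V1) + 2 * int (card ?V2)"
    using sum_edges[of "\<lambda>_. 1"] by (simp flip: deg_def)
  then have n12: "n = 2 + card ?V1 + 2 * card ?V2" using card_E by linarith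
  have "verts T = insert w (?V1 \<union> ?V2 \<union> ?VD)" using others w by blast
  moreover have "card (insert w (?V1 \<union> ?V2 \<union> ?VD)) = 1 + card ?V1 + card ?V2 + card ?VD"
  proof -
    have "card (insert w (?V1 \<union> ?V2 \<union> ?VD)) = Suc (card (?V1 \<union> ?V2 \<union> ?VD))"
      using fin dwne by (intro card_insert_disjoint) auto
    also have "card (?V1 \<union> ?V2 \<union> ?VD) = card (?V1 \<union> ?V2) + card ?VD"
      using fin \<Delta>4 by (intro card_Un_disjoint) auto
    also have "card (?V1 \<union> ?V2) = card ?V1 + card ?V2"
      using fin by (intro card_Un_disjoint) auto
    finally show ?thesis by simp
  qed
  ultimately have n12D: "n = 1 + card ?V1 + card ?V2 + card ?VD" using card_n by simp
  have VD: "card ?VD = k"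
  proof -
    let ?F = "{e \<in> edges T. e \<inter> ?VD \<noteq> {}}" and ?W = "{u \<in> nbrs T w. deg T u = 2}"
    have "card ?F = (\<Sum>v\<in>?VD. \<Sum>u\<in>nbrs T v. 1)"
      using sum_edges_meeting_independent[OF G, of ?VD "\<lambda>_. 1::nat"] no\<Delta>\<Delta> by auto
    then have F: "card ?F = card ?VD * \<Delta>" by (simp flip: deg_def)
    \<comment> \<open>An edge avoiding degree \<Delta> has no leaf as an end, and two ends of degree
      2 are excluded; hence it joins \<open>w\<close> to a vertex of degree 2.\<close>
    have "e \<in> (\<lambda>u. {u, w}) ` ?W" if e: "e \<in> edges T" "e \<inter> ?VD = {}" for e
    proof -
      obtain u v where uv: "e = {u, v}" "u \<in> verts T" "v \<in> verts T" "u \<noteq> v"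
        using simple_graph_edgeE[OF G e(1)] by blast
      then have edge: "{u, v} \<in> edges T" "{v, u} \<in> edges T" and "deg T u \<noteq> \<Delta>" "deg T v \<noteq> \<Delta>"
        using e by (auto simp: insert_commute)
      then have "deg T u \<noteq> 1" "deg T v \<noteq> 1" using nbrs1 by blast+
      moreover have "u = w \<or> v = w"
        using others[OF uv(2)] nbrs2[OF edge(1)] \<open>deg T u \<noteq> 1\<close> \<open>deg T u \<noteq> \<Delta>\<close> \<open>deg T v \<noteq> \<Delta>\<close>
        by blast
      ultimately have "u = w \<and> deg T v = 2 \<or> v = w \<and> deg T u = 2"
        using others[OF uv(2)] others[OF uv(3)] uv(4) \<open>deg T u \<noteq> \<Delta>\<close> \<open>deg T v \<noteq> \<Delta>\<close> by blast
      then show ?thesis using edge uv(1) by (auto simp: nb insert_commute)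
    qed
    then have "edges T = ?F \<union> (\<lambda>u. {u, w}) ` ?W" by (auto simp: nb)
    then have "card (edges T) = card (?F \<union> (\<lambda>u. {u, w}) ` ?W)" by (rule arg_cong)
    also have "\<dots> = card ?F + card ((\<lambda>u. {u, w}) ` ?W)"
      using finite_edges[OF G] finite_nbrs[OF G] dwne \<Delta>4 by (intro card_Un_disjoint) auto
    also have "card ((\<lambda>u. {u, w}) ` ?W) = j"
      using w2 by (subst card_image) (auto simp: inj_on_def doubleton_eq_iff)
    finally have "card ?VD * \<Delta> + j = k * \<Delta> + j" using F card_E n by linarith
    then show ?thesis using \<Delta>4 by simp
  qed

  have "(\<Sum>u\<in>nbrs T v. edge_imbalance T {u, v}) = (int \<Delta> - 1)\<^sup>2" if "v \<in> ?V1" for v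
  proof -
    have "(\<Sum>u\<in>nbrs T v. edge_imbalance T {u, v}) = (\<Sum>u\<in>nbrs T v. (int \<Delta> - 1)\<^sup>2)"
      using that nbrs1[of v] by (intro sum.cong) (auto simp: edge_imbalance_pair nb insert_commute)
    then show ?thesis using that by (simp flip: deg_def)
  qed
  then have s1: "(\<Sum>v\<in>?V1. \<Sum>u\<in>nbrs T v. edge_imbalance T {u, v}) = int (card ?V1) * (int \<Delta> - 1)\<^sup>2"
    by simp
  \<comment> \<open>The change in one summand when the neighbour of a vertex of degree 2 is
    \<open>w\<close>, of degree \<open>j + 1\<close>, instead of a vertex of degree
    \<Delta>.\<close>
  let ?d = "(int j - 1)\<^sup>2 - (int \<Delta> - 2)\<^sup>2"
  have "(\<Sum>u\<in>nbrs T v. edge_imbalance T {u, v}) = 2 * (int \<Delta> - 2)\<^sup>2 + (if v \<in> nbrs T w then ?d else 0)"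
    if "v \<in> ?V2" for v
  proof -
    have "(\<Sum>u\<in>nbrs T v. edge_imbalance T {u, v})
        = (\<Sum>u\<in>nbrs T v. (int \<Delta> - 2)\<^sup>2 + (if u = w then ?d else 0))"
      using that nbrs2[of v] dw
      by (intro sum.cong) (auto simp: edge_imbalance_pair nb insert_commute)
    also have "\<dots> = int (deg T v) * (int \<Delta> - 2)\<^sup>2 + (if w \<in> nbrs T v then ?d else 0)"
      using finite_nbrs[OF G] by (simp add: sum.distrib deg_def)
    finally show ?thesis using that nbrs_commute[OF G, of w v] by simp
  qed
  note sum_nbrs2 = this
  have "(\<Sum>v\<in>?V2. \<Sum>u\<in>nbrs T v. edge_imbalance T {u, v})
      = (\<Sum>v\<in>?V2. 2 * (int \<Delta> - 2)\<^sup>2 + (if v \<in> nbrs T w then ?d else 0))"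
    by (intro sum.cong refl sum_nbrs2)
  also have "\<dots> = int (card ?V2) * (2 * (int \<Delta> - 2)\<^sup>2) + (\<Sum>v\<in>?V2 \<inter> {v. v \<in> nbrs T w}. ?d)"
    using fin by (simp add: sum.distrib sum.If_cases)
  also have "?V2 \<inter> {v. v \<in> nbrs T w} = {u \<in> nbrs T w. deg T u = 2}"
    by (auto simp: nbrs_def)
  finally have s2: "(\<Sum>v\<in>?V2. \<Sum>u\<in>nbrs T v. edge_imbalance T {u, v})
      = int (card ?V2) * (2 * (int \<Delta> - 2)\<^sup>2) + int j * ?d"
    using w2 by simp
  have s0: "edge_imbalance T {c, w} = (int \<Delta> - int j - 1)\<^sup>2"
    using c' dw by (simp add: edge_imbalance_pair algebra_simps)
  have "int (card ?V1) = int n - 2 * int k" "int (card ?V2) = int k - 1"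
    using n12 n12D VD by linarith+
  then show ?thesis
    unfolding sigma_irr_def sum_edges[of "edge_imbalance T"] s0 s1 s2 by simp
qed

section \<open>Trees given by a parent map\<close>

text \<open>Since \<open>rank\<close> drops along \<open>p\<close>, iterating \<open>p\<close> must
  end at \<open>r\<close>. Nothing is assumed about \<open>p r\<close>.\<close>

locale parent_tree =
  fixes V :: "'a set" and r :: 'a and p :: "'a \<Rightarrow> 'a" and rank :: "'a \<Rightarrow> nat"
  assumes finite_V: "finite V" and root: "r \<in> V"
    and parent: "v \<in> V \<Longrightarrow> v \<noteq> r \<Longrightarrow> p v \<in> V"
    and rank_parent: "v \<in> V \<Longrightarrow> v \<noteq> r \<Longrightarrow> rank (p v) < rank v"
begin

definition graph :: "'a sgraph" where
  "graph = \<lparr>verts = V, edges = (\<lambda>v. {v, p v}) ` (V - {r})\<rparr>"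

lemma verts_graph [simp]: "verts graph = V"
  by (simp add: graph_def)

lemma edge_iff: "{u, v} \<in> edges graph \<longleftrightarrow>
    u \<in> V \<and> u \<noteq> r \<and> v = p u \<or> v \<in> V \<and> v \<noteq> r \<and> u = p v"
  by (auto simp: graph_def doubleton_eq_iff image_iff)

lemma simple: "simple_graph graph"
  unfolding simple_graph_def graph_def using finite_V parent rank_parent by fastforce

definition children :: "'a \<Rightarrow> 'a set" where
  "children v = {u \<in> V - {r}. p u = v}"

lemma nbrs_graph:
  assumes "v \<in> V"
  shows "nbrs graph v = children v \<union> (if v = r then {} else {p v})"
  using assms parent by (auto simp: nbrs_def edge_iff children_def)

lemma deg_graph:
  assumes "v \<in> V"
  shows "deg graph v = card (children v) + (if v = r then 0 else 1)"
proof (cases "v = r")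
  case False
  \<comment> \<open>Otherwise \<open>v\<close> and \<open>p v\<close> would be parents of each
    other, each of smaller rank than the other.\<close>
  have "p v \<notin> children v"
    using rank_parent[of v] rank_parent[of "p v"] assms False by (auto simp: children_def)
  moreover have "finite (children v)" using finite_V by (simp add: children_def)
  ultimately show ?thesis using assms False by (simp add: deg_def nbrs_graph)
qed (use assms in \<open>simp add: deg_def nbrs_graph\<close>)

text \<open>By induction on the rank every vertex reaches the root, and adjacency is symmetric, so
  any two vertices are joined through the root.\<close>

lemma connected: "connected_graph graph"
proof -
  define R where "R = {(u, v). u \<in> V \<and> v \<in> V \<and> {u, v} \<in> edges graph}"
  have "sym R" by (auto simp: R_def sym_def insert_commute)
  have root_reach: "v \<in> V \<Longrightarrow> (v, r) \<in> R\<^sup>*" for v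
  proof (induction "rank v" arbitrary: v rule: less_induct)
    case less
    show ?case
    proof (cases "v = r")
      case False
      then have "(v, p v) \<in> R" using less.prems parent by (auto simp: R_def edge_iff)
      moreover have "(p v, r) \<in> R\<^sup>*" using less rank_parent parent False by blast
      ultimately show ?thesis by simp
    qed simp
  qed
  have walk: "(u, v) \<in> R\<^sup>* \<Longrightarrow> v \<in> V \<Longrightarrow> \<exists>xs. walk graph xs \<and> hd xs = u \<and> last xs = v" for u v
  proof (induction rule: converse_rtrancl_induct)
    case base
    then show ?case by (intro exI[of _ "[v]"]) (simp add: walk_def)
  next
    case (step y z)
    then obtain xs where "walk graph xs" "hd xs = z" "last xs = v" by blast
    moreover from this have "xs \<noteq> []" by (simp add: walk_def)
    ultimately show ?case using step(1) by (intro exI[of _ "y # xs"]) (auto simp: walk_Cons R_def)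
  qed
  have "(u, v) \<in> R\<^sup>*" if "u \<in> V" "v \<in> V" for u v
    using root_reach[OF that(1)] root_reach[OF that(2)] sym_rtrancl[OF \<open>sym R\<close>]
    by (meson rtrancl_trans symD)
  then show ?thesis using walk root unfolding connected_graph_def by auto
qed

text \<open>Both neighbours on a cycle of a vertex of maximal rank would have to be its parent.\<close>
lemma acyclic: "\<not> is_cycle graph xs"
proof
  assume cyc: "is_cycle graph xs"
  define L where "L = length xs"
  have L: "L \<ge> 3" and dist: "distinct xs" and "set xs \<subseteq> V"
    using cyc by (auto simp: is_cycle_def walk_def L_def)
  have next_edge: "{xs ! i, xs ! (Suc i mod L)} \<in> edges graph" if "i < L" for i
  proof (cases "Suc i < L")
    case True
    then show ?thesis using cyc
      by (auto simp: is_cycle_def walk_def L_def successively_conv_nth)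
  next
    case False
    then have "Suc i = L" using that by simp
    then have i: "i = length xs - 1" "xs \<noteq> []" "Suc i mod L = 0" using L by (auto simp: L_def)
    then have "xs ! (Suc i mod L) = hd xs" "xs ! i = last xs"
      by (simp_all add: last_conv_nth hd_conv_nth)
    then show ?thesis using cyc by (simp add: is_cycle_def)
  qed
  have "hd xs \<in> set xs" using L by (intro hd_in_set) (auto simp: L_def)
  then have "\<exists>x. x \<in> set xs \<and> (\<forall>y. y \<in> set xs \<longrightarrow> rank y \<le> rank x)"
    by (rule ex_has_greatest_nat[of _ "hd xs" _ "Suc (Max (rank ` set xs))"])
      (auto simp: less_Suc_eq_le)
  then obtain i where i: "i < L" and top: "\<And>l. l < L \<Longrightarrow> rank (xs ! l) \<le> rank (xs ! i)"
    unfolding L_def by (metis in_set_conv_nth)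
  \<comment> \<open>The other orientation of the edge would give \<open>xs ! l\<close> a rank above
    the maximum.\<close>
  have to_parent: "xs ! l = p (xs ! i)" if "{xs ! i, xs ! l} \<in> edges graph" "l < L" for l
    using that top[of l] rank_parent[of "xs ! l"] by (auto simp: edge_iff)
  \<comment> \<open>\<open>a\<close> and \<open>b\<close> are the cyclic predecessor and successor
    of \<open>i\<close>; they differ because the cycle has length at least 3.\<close>
  define a where "a = (if i = 0 then L - 1 else i - 1)"
  have a: "a < L" "Suc a mod L = i" using i L by (auto simp: a_def)
  define b where "b = Suc i mod L"
  have b: "b < L" "a \<noteq> b" using i L by (auto simp: a_def b_def mod_Suc)
  have "xs ! a = xs ! b"
    using to_parent[of a] to_parent[of b] next_edge[OF a(1)] next_edge[OF i] a b
    by (simp add: insert_commute b_def)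
  then show False using dist a b by (simp add: L_def nth_eq_iff_index_eq)
qed

lemma tree: "is_tree graph"
  by (simp add: is_tree_def simple connected acyclic)

end

section \<open>A member of the family\<close>

text \<open>The bound \<open>j < k\<close> provides blocks 0 to \<open>j\<close>: one for the medium
  vertex and one for each of its neighbours of degree 2.\<close>

locale family_member =
  fixes \<Delta> k j :: nat
  assumes j: "2 \<le> j" "j + 2 \<le> \<Delta>" "j < k"
begin

text \<open>Block \<open>i\<close> holds a hub \<open>(i, 1)\<close> of degree \<open>\<Delta>\<close>, the leaves \<open>(i, 2), \<dots>, (i, width i)\<close>
  attached to it, and the vertex \<open>(i, 0)\<close> on its path to the root: this is the medium
  vertex for \<open>i = 0\<close>, a vertex of degree 2 adjacent to the medium vertex for \<open>1 \<le> i \<le> j\<close>,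
  and a vertex of degree 2 adjacent to the previous hub for \<open>i > j\<close>.\<close>

definition width :: "nat \<Rightarrow> nat" where
  "width i = (if j \<le> i \<and> i + 1 < k then \<Delta> - 1 else \<Delta>)"

lemma width_pos [simp]: "Suc 0 \<le> width i"
  using j by (auto simp: width_def)

definition X :: "(nat \<times> nat) set" where
  "X = (SIGMA i:{..<k}. {..width i})"

fun q :: "nat \<times> nat \<Rightarrow> nat \<times> nat" where
  q_Pair: "q (i, m) = (if m = 0 then if i \<le> j then (0, 0) else (i - 1, 1)
    else if m = 1 then (i, 0) else (i, 1))"

declare q_Pair [simp del]

text \<open>Pairs are encoded as numbers so that the witness is a \<open>nat sgraph\<close>.\<close>

definition V :: "nat set" where
  "V = prod_encode ` X"

lemma ball_V: "(\<forall>v\<in>V. P v) \<longleftrightarrow> (\<forall>i<k. \<forall>m\<le>width i. P (prod_encode (i, m)))"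
  by (auto simp: V_def X_def)

lemma V_cases:
  assumes "v \<in> V"
  obtains i m where "v = prod_encode (i, m)" "i < k" "m \<le> width i"
  using assms by (auto simp: V_def X_def)

lemma encode_in_V [simp]: "prod_encode (i, m) \<in> V \<longleftrightarrow> i < k \<and> m \<le> width i"
  by (auto simp: V_def X_def inj_image_mem_iff inj_prod_encode)

text \<open>The factor 2 in the rank makes the step from \<open>(i, 0)\<close> to the hub
  \<open>(i - 1, 1)\<close> decrease it, from \<open>2 * i\<close> to
  \<open>2 * i - 1\<close>.\<close>

sublocale parent_tree V "prod_encode (0, 0)" "\<lambda>v. prod_encode (q (prod_decode v))"
  "\<lambda>v. case prod_decode v of (i, m) \<Rightarrow> 2 * i + m"
proof
  show "finite V" by (simp add: V_def X_def)
  show "prod_encode (0, 0) \<in> V" using j by simp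
  fix v assume "v \<in> V" "v \<noteq> prod_encode (0, 0)"
  then obtain i m where "v = prod_encode (i, m)" "i < k" "m \<le> width i" "(i, m) \<noteq> (0, 0)"
    by (auto simp: V_def X_def)
  then show "prod_encode (q (prod_decode v)) \<in> V"
    and "(case prod_decode (prod_encode (q (prod_decode v))) of (i, m) \<Rightarrow> 2 * i + m)
      < (case prod_decode v of (i, m) \<Rightarrow> 2 * i + m)"
    using j by (auto simp: q_Pair width_def)
qed

text \<open>The \<open>k - 1 - j\<close> blocks from \<open>j\<close> to \<open>k - 2\<close> have
  \<Delta> vertices each, the other \<open>j + 1\<close> blocks one more.\<close>

lemma card_V: "card V = k * \<Delta> + 1 + j"
proof -
  have "card V = (\<Sum>i<k. Suc (width i))"
    by (simp add: V_def X_def card_image inj_prod_encode)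
  also have "\<dots> = (\<Sum>i\<in>{..<k} - {j..<k - 1}. Suc (width i)) + (\<Sum>i\<in>{j..<k - 1}. Suc (width i))"
    by (rule sum.subset_diff) auto
  also have "(\<Sum>i\<in>{j..<k - 1}. Suc (width i)) = (\<Sum>i\<in>{j..<k - 1}. \<Delta>)"
    using j by (intro sum.cong) (auto simp: width_def)
  also have "(\<Sum>i\<in>{..<k} - {j..<k - 1}. Suc (width i)) = (\<Sum>i\<in>{..<k} - {j..<k - 1}. Suc \<Delta>)"
    using j by (intro sum.cong) (auto simp: width_def)
  also have "\<dots> + (\<Sum>i\<in>{j..<k - 1}. \<Delta>) = (k - (k - 1 - j)) * Suc \<Delta> + (k - 1 - j) * \<Delta>"
    by (subst sum_constant, subst card_Diff_subset) auto
  also have "\<dots> = (j + 1) * Suc \<Delta> + (k - 1 - j) * \<Delta>" using j by simp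
  also have "\<dots> = (j + 1 + (k - 1 - j)) * \<Delta> + 1 + j" by (simp add: algebra_simps)
  also have "j + 1 + (k - 1 - j) = k" using j by simp
  finally show ?thesis .
qed

section \<open>Children and degrees in the constructed tree\<close>

definition C :: "nat \<times> nat \<Rightarrow> (nat \<times> nat) set" where
  "C x = {y \<in> X - {(0, 0)}. q y = x}"

lemma children_encode: "children (prod_encode x) = prod_encode ` C x"
  by (auto simp: C_def children_def X_def elim!: V_cases)

lemma C_root: "C (0, 0) = insert (0, 1) ((\<lambda>i. (i, 0)) ` {1..j})"
  using j by (auto simp: C_def X_def q_Pair width_def split: if_splits)

lemma C_path: "0 < i \<Longrightarrow> i < k \<Longrightarrow> C (i, 0) = {(i, 1)}"
  using j by (auto simp: C_def X_def q_Pair width_def split: if_splits)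

text \<open>A hub followed by another block on its path has that block's \<open>(i + 1, 0)\<close>
  as a child; \<open>width\<close> grants it one leaf fewer, so every hub has
  \<open>\<Delta> - 1\<close> children.\<close>

lemma C_hub: "i < k \<Longrightarrow> C (i, 1)
    = Pair i ` {2..width i} \<union> (if j \<le> i \<and> i + 1 < k then {(i + 1, 0)} else {})"
  using j by (auto simp: C_def X_def q_Pair width_def split: if_splits)

lemma C_leaf: "2 \<le> m \<Longrightarrow> C (i, m) = {}"
  by (auto simp: C_def q_Pair split: if_splits)

lemma deg_encode:
  assumes "i < k" "m \<le> width i"
  shows "deg graph (prod_encode (i, m)) =
    (if m = 0 then if i = 0 then j + 1 else 2 else if m = 1 then \<Delta> else 1)"
proof -
  have d: "deg graph (prod_encode (i, m)) = card (C (i, m))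
      + (if (i, m) = (0, 0) then 0 else 1)"
    using assms by (simp add: deg_graph children_encode card_image inj_on_def)
  consider "m = 0" "i = 0" | "m = 0" "i > 0" | "m = 1" | "m \<ge> 2" by linarith
  then show ?thesis
  proof cases
    case 1
    then show ?thesis unfolding d
      by (simp add: C_root card_insert_if card_image inj_on_def image_iff)
  next
    case 2
    then show ?thesis using assms C_path[of i] d by simp
  next
    case 3
    have "card (C (i, 1)) = \<Delta> - 1"
      unfolding C_hub[OF assms(1)] using j
      by (subst card_Un_disjoint) (auto simp: card_image inj_on_def width_def)
    then show ?thesis using 3 d j by simp
  next
    case 4
    then show ?thesis by (simp add: d C_leaf)
  qed
qed

lemma nbrs_encode:
  assumes "i < k" "m \<le> width i"
  shows "nbrs graph (prod_encode (i, m)) = prod_encode ` (C (i, m)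
    \<union> (if (i, m) = (0, 0) then {} else {q (i, m)}))"
  using assms by (simp add: nbrs_graph children_encode image_Un)

lemma nbrs_medium:
  "nbrs graph (prod_encode (0, 0)) = insert (prod_encode (0, 1)) ((\<lambda>i. prod_encode (i, 0)) ` {1..j})"
  using j by (simp add: nbrs_encode C_root image_image)

section \<open>Membership of the constructed tree in the family\<close>

lemma max_deg_graph: "max_deg graph = \<Delta>"
  unfolding max_deg_def
proof (rule Max_eqI)
  show "finite (deg graph ` verts graph)" using finite_V by simp
  show "y \<le> \<Delta>" if "y \<in> deg graph ` verts graph" for y
  proof -
    have "\<forall>v\<in>V. deg graph v \<le> \<Delta>" using j by (auto simp: ball_V deg_encode)
    then show ?thesis using that by auto
  qed
  have "deg graph (prod_encode (0, 1)) = \<Delta>" using j by (subst deg_encode) (auto simp: width_def)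
  moreover have "prod_encode (0, 1) \<in> V" using j by (simp add: width_def)
  ultimately show "\<Delta> \<in> deg graph ` verts graph" by (metis image_eqI verts_graph)
qed

text \<open>All neighbours of a vertex \<open>(i, 0)\<close> have degree above 1 and there are at
  least two, so it is no internal leaf; vertices with \<open>m\<close> at least 2 are leaves. Only
  hubs remain.\<close>

lemma internal_leaf_deg:
  assumes "internal_leaf graph v"
  shows "deg graph v = \<Delta>"
proof -
  obtain i m where v: "v = prod_encode (i, m)" "i < k" "m \<le> width i"
    using assms V_cases[of v] by (auto simp: internal_leaf_def)
  have deg2: "deg graph v \<ge> 2" and card1: "card {u \<in> nbrs graph v. deg graph u > 1} = 1"
    using assms by (auto simp: internal_leaf_def)
  have "m \<noteq> 0"
  proof
    assume m: "m = 0"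
    have "\<forall>x \<in> C (i, 0) \<union> (if i = 0 then {} else {q (i, 0)}).
        deg graph (prod_encode x) > 1"
      using j v(2) m
      by (cases "i = 0") (auto simp: C_root C_path deg_encode q_Pair)
    then have "{u \<in> nbrs graph v. deg graph u > 1} = nbrs graph v"
      using v m by (auto simp: nbrs_encode split: if_splits)
    then show False using deg2 card1 by (simp add: deg_def)
  qed
  with v deg2 show ?thesis by (auto simp: deg_encode split: if_splits)
qed

text \<open>Every vertex other than the root differs in degree from its parent, so the two
  hypotheses are contradictory.\<close>

lemma edge_degs:
  assumes "{u, v} \<in> edges graph" "deg graph u = deg graph v"
  shows "deg graph u \<noteq> 2" "deg graph u \<noteq> \<Delta>"
proof -
  have *: "deg graph v \<noteq> deg graph (prod_encode (q (prod_decode v)))"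
    if "v \<in> V" "v \<noteq> prod_encode (0, 0)" for v
    using that parent[OF that] j by (auto simp: q_Pair deg_encode elim!: V_cases split: if_splits)
  show "deg graph u \<noteq> 2" "deg graph u \<noteq> \<Delta>"
    using assms * unfolding edge_iff by metis+
qed

lemma graph_in_T_family: "graph \<in> T_family (k * \<Delta> + 1 + j) \<Delta>"
proof -
  let ?w = "prod_encode (0, 0)"
  have deg_w: "deg graph ?w = j + 1" using j by (simp add: deg_encode)
  then have "medium_vertex graph ?w"
    using j by (auto simp: medium_vertex_def max_deg_graph)
  moreover have "\<forall>v\<in>verts graph - {?w}. deg graph v \<in> {1, 2, \<Delta>}"
    by (auto simp: deg_encode elim!: V_cases split: if_splits)
  moreover have degs: "deg graph (prod_encode (0, 1)) = \<Delta>"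
      "\<And>i. i \<in> {1..j} \<Longrightarrow> deg graph (prod_encode (i, 0)) = 2"
    using j by (auto simp: deg_encode width_def)
  then have "{u \<in> nbrs graph ?w. deg graph u = 2} = (\<lambda>i. prod_encode (i, 0)) ` {1..j}"
      "{u \<in> nbrs graph ?w. deg graph u = \<Delta>} = {prod_encode (0, 1)}"
    using j by (auto simp: nbrs_medium)
  then have "card {u \<in> nbrs graph ?w. deg graph u = 2} = j"
      "card {u \<in> nbrs graph ?w. deg graph u = \<Delta>} = 1"
    by (simp_all add: card_image inj_on_def)
  moreover have "m_edges graph 2 2 = 0" "m_edges graph \<Delta> \<Delta> = 0"
    unfolding m_edges_eq_0_iff[OF simple] using edge_degs by metis+
  moreover have "2 \<le> j" "j \<le> \<Delta> - 2" using j by auto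
  ultimately show ?thesis
    unfolding T_family_def using tree card_V max_deg_graph internal_leaf_deg deg_w
    by (simp only: mem_Collect_eq verts_graph) blast
qed

end

theorem proposition8:
  fixes \<Delta> n k j :: nat
  assumes "\<Delta> \<ge> 6"
    and "n = k * \<Delta> + 1 + j"
    and "k \<ge> \<Delta> - 1"
    and "2 \<le> j" and "j \<le> \<Delta> - 2"
  shows "(T_family n \<Delta> :: nat sgraph set) \<noteq> {} \<and>
    (\<forall>S \<in> (T_family n \<Delta> :: 'a sgraph set). \<forall>T \<in> (T_family n \<Delta> :: 'b sgraph set).
       sigma_irr S = sigma_irr T)"
proof
  \<comment> \<open>Here \<open>j < k\<close> follows from \<open>j \<le> \<Delta> - 2\<close> and
    \<open>k \<ge> \<Delta> - 1\<close>.\<close>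
  have "family_member \<Delta> k j" using assms by unfold_locales auto
  from family_member.graph_in_T_family[OF this]
  show "(T_family n \<Delta> :: nat sgraph set) \<noteq> {}" using assms(2) by auto
  \<comment> \<open>The closed formula mentions only \<open>n\<close>, \<Delta>, \<open>k\<close>
    and \<open>j\<close>, so trees over different vertex types can be compared.\<close>
  show "\<forall>S \<in> (T_family n \<Delta> :: 'a sgraph set). \<forall>T \<in> (T_family n \<Delta> :: 'b sgraph set).
      sigma_irr S = sigma_irr T"
    using T_family_sigma_irr[OF _ assms(2,4,5)] by metis
qed

end
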